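(* Let $(\mathbf a,\mathbf b,\mathbf c)$ be the maximal forward solution, on $[0,T^* )$, of $$\dot{\mathbf a}=\mathbf b\mathbf c,\qquad \dot{\mathbf b}=\mathbf a\mathbf c^{\top},\qquad \dot{\mathbf c}=\mathbf b^{\top}\mathbf a ,$$ with $\mathbf a(t),\mathbf c(t)\in\mathbb R^m$, $\mathbf b(t)\in\mathbb R^{m\times m}$, and let $E=\mathbf a^{\top}\mathbf b\mathbf c$. Suppose that the final stage condition holds at some time $t_0<T^*$, and let $T_2$ be the time described in the context. Then there exist $T_3\in(T_2,T^* )$ and $C\ge1$ such that the following upper bound on the energy $E$ holds: $$E(t)\le\frac{1}{\left(E(s)^{-1/3}-C(t-s)\right)^3},\qquad T_3\le s<t<T^* .$$ Moreover, the blow-up time $T^*$ is bounded below by $$T^*\ge t+\frac{E(t)^{-1/3}}{C},\qquad t<T^* .$$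
   Context: $m\ge1$ is an integer; $T^*$ is the right endpoint of the maximal interval of existence (the blow-up time). $\mathbf b_i$ denotes the $i$-th row of $\mathbf b$ (a row vector), $\mathbf b^i$ its $i$-th column, $a_i,c_i$ the entries of $\mathbf a,\mathbf c$, $\langle\cdot,\cdot\rangle$ the standard inner product. Final stage condition at time $t$: (1) for every $i\in\{1,\dots,m\}$, $c_i\,\mathbf a^{\top}\mathbf b^i>0$ and $a_i\,\mathbf b_i\mathbf c>0$ at time $t$; (2) for every $i,j\in\{1,\dots,m\}$, $\langle c_i\mathbf b^i,c_j\mathbf b^j\rangle>0$ and $\langle a_i\mathbf b_i,a_j\mathbf b_j\rangle>0$ at time $t$. The times $T_1<T_2$ are those supplied by earlier results under the same assumption: let $C_1$ be the set of indices $i$ with $\lim_{t\to T^*}c_i^2=+\infty$; $T_1\in(t_0,T^* )$ and $\Theta_1\in[0,\frac{\pi}{2})$ are such that for every $i\in C_1$ the angle $\varphi_i(t)$ between $\mathbf a(t)$ and $c_i(t)\mathbf b^i(t)$ satisfies $\cos\varphi_i(t)\ge\cos\Theta_1$ for $t\in(T_1,T^* )$; and $T_2\in(T_1,T^* )$ and $\Theta_2\in[0,\frac{\pi}{2})$ are such that the angle $\zeta(t)$ between $\mathbf a(t)$ and $\dot{\mathbf a}(t)$ satisfies $\cos\zeta(t)\ge\cos\Theta_2$ for $t\in(T_2,T^* )$.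
   Formalization: The upper bound is asserted only where E(s)^{-1/3} − C(t−s) > 0 (otherwise its right side is negative or undefined), and the lower bound on T* only for t₀ ≤ t < T*, since earlier E(t) may be nonpositive or cross zero, so that no single C works. *)

theory Defs
  imports "HOL-Analysis.Analysis"
begin

text \<open>The right endpoint of an interval of existence is an extended real, so that finiteness
  of the maximal time is not presupposed.\<close>

definition forward_interval :: "ereal \<Rightarrow> real set" where
  "forward_interval T = {t. 0 \<le> t \<and> ereal t < T}"

text \<open>The product of a column and a row, \<open>a c\<^sup>\<top>\<close>.\<close>

definition outer_prod :: "real ^ 'm \<Rightarrow> real ^ 'm \<Rightarrow> real ^ 'm ^ 'm" where
  "outer_prod a c = (\<chi> i j. a $ i * c $ j)"

text \<open>Derivatives are taken within the interval, hence one-sided at time \<open>0\<close>.  Values of the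
  functions outside the interval are irrelevant.\<close>

definition is_solution ::
  "(real \<Rightarrow> real ^ 'm) \<Rightarrow> (real \<Rightarrow> real ^ 'm ^ 'm) \<Rightarrow> (real \<Rightarrow> real ^ 'm) \<Rightarrow> ereal \<Rightarrow> bool" where
  "is_solution a b c T \<longleftrightarrow> (\<forall>t \<in> forward_interval T.
     (a has_vector_derivative (b t *v c t)) (at t within forward_interval T) \<and>
     (b has_vector_derivative (outer_prod (a t) (c t))) (at t within forward_interval T) \<and>
     (c has_vector_derivative (transpose (b t) *v a t)) (at t within forward_interval T))"

definition is_maximal_solution ::
  "(real \<Rightarrow> real ^ 'm) \<Rightarrow> (real \<Rightarrow> real ^ 'm ^ 'm) \<Rightarrow> (real \<Rightarrow> real ^ 'm) \<Rightarrow> ereal \<Rightarrow> bool" where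
  "is_maximal_solution a b c T \<longleftrightarrow> 0 < T \<and> is_solution a b c T \<and>
     \<not> (\<exists>a' b' c' T'. T < T' \<and> is_solution a' b' c' T' \<and>
          (\<forall>t \<in> forward_interval T. a' t = a t \<and> b' t = b t \<and> c' t = c t))"

definition energy :: "real ^ 'm \<Rightarrow> real ^ 'm ^ 'm \<Rightarrow> real ^ 'm \<Rightarrow> real" where
  "energy a b c = a \<bullet> (b *v c)"

definition final_stage :: "real ^ 'm \<Rightarrow> real ^ 'm ^ 'm \<Rightarrow> real ^ 'm \<Rightarrow> bool" where
  "final_stage a b c \<longleftrightarrow>
     (\<forall>i. c $ i * (a \<bullet> column i b) > 0 \<and> a $ i * (row i b \<bullet> c) > 0) \<and>
     (\<forall>i j. (c $ i *\<^sub>R column i b) \<bullet> (c $ j *\<^sub>R column j b) > 0 \<and>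
            (a $ i *\<^sub>R row i b) \<bullet> (a $ j *\<^sub>R row j b) > 0)"

text \<open>If one of the vectors is \<open>0\<close>, division by zero makes this \<open>pi / 2\<close>.\<close>

definition vec_angle :: "'a::real_inner \<Rightarrow> 'a \<Rightarrow> real" where
  "vec_angle x y = arccos (x \<bullet> y / (norm x * norm y))"

text \<open>The filter below is real \<open>t\<close> tending to \<open>T\<close> from the left: it is \<open>at_left T\<close> for
  finite \<open>T\<close> and \<open>at_top\<close> for \<open>T = \<infinity>\<close>.\<close>

definition blow_up_indices :: "(real \<Rightarrow> real ^ 'm) \<Rightarrow> ereal \<Rightarrow> 'm set" where
  "blow_up_indices c T =
     {i. filterlim (\<lambda>t. (c t $ i)\<^sup>2) at_top (filtercomap ereal (at_left T))}"

end

theory Submission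
  imports Defs
begin

text \<open>Along the flow \<open>E' = |F|\<^sup>2\<close>, where \<open>F\<close> is the quadratic vector field, hence \<open>E' = O(|a|\<^sup>4)\<close> because
  \<open>|b|\<^sup>2 - |a|\<^sup>2\<close> and \<open>|c|\<^sup>2 - |a|\<^sup>2\<close> are conserved. The matrix \<open>b\<^sup>\<top> b - c c\<^sup>\<top>\<close> is conserved too,
  so \<open>|b c|\<^sup>2 \<ge> |c|\<^sup>4 - O(|c|\<^sup>2)\<close>, and the angle condition between \<open>a\<close> and \<open>a' = b c\<close> makes \<open>E\<close> at
  least a multiple of \<open>|a|\<^sup>3\<close> once \<open>|a|\<close> is large. Together, \<open>E' \<le> 3 C E\<^bsup>4/3\<^esup>\<close>, that is,
  \<open>E\<^bsup>-1/3\<^esup> + C t\<close> is nondecreasing. That \<open>|a|\<close> does tend to infinity follows from \<open>(|a|\<^sup>2)' = 2 E\<close> with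
  \<open>E\<close> nondecreasing and positive if \<open>T\<^sup>* = \<infinity>\<close>, and otherwise from the fact that a bounded solution
  extends beyond its interval of existence.\<close>

section \<open>Local existence and continuation of bounded solutions\<close>

text \<open>Banach's fixed point theorem for the Picard operator. It acts on bounded continuous
  functions on the whole line with values in the ball, a closed subset of a Banach space and hence
  complete.\<close>

lemma picard_lindelof_forward:
  fixes f :: "'a::banach \<Rightarrow> 'a"
  assumes lip: "L-lipschitz_on (cball x0 r) f" and r: "r > 0"
  obtains \<delta> y where "\<delta> > 0" "y T = x0"
    "\<And>t. t \<in> {T..T+\<delta>} \<Longrightarrow> (y has_vector_derivative f (y t)) (at t within {T..T+\<delta>})"
proof -
  have L: "L \<ge> 0" using lip by (rule lipschitz_on_nonneg)
  define M where "M = norm (f x0) + L * r + 1"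
  have M: "M > 0" using L r by (simp add: M_def add_nonneg_pos)
  have fM: "norm (f x) \<le> M" if "x \<in> cball x0 r" for x
  proof -
    have "dist (f x) (f x0) \<le> L * dist x x0"
      using that r by (intro lipschitz_onD[OF lip]) auto
    also have "\<dots> \<le> L * r" using that L by (intro mult_left_mono) (auto simp: dist_commute)
    finally show ?thesis unfolding M_def dist_norm
      using norm_triangle_sub[of "f x" "f x0"] by linarith
  qed
  \<comment> \<open>The first bound on the length keeps Picard iterates within distance
    \<open>r\<close> of \<open>x0\<close>, the second makes the operator a contraction with factor
    \<open>1/2\<close>. The summand \<open>1\<close> in \<open>M\<close> keeps the divisor
    positive.\<close>
  define \<delta> where "\<delta> = min (r / M) (1 / (2 * (L + 1)))"
  have \<delta>: "\<delta> > 0" using L r M by (simp add: \<delta>_def)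
  have M\<delta>: "M * \<delta> \<le> r"
  proof -
    have "M * \<delta> \<le> M * (r / M)" using M by (intro mult_left_mono) (auto simp: \<delta>_def)
    then show ?thesis using M by simp
  qed
  have L\<delta>: "L * \<delta> \<le> 1 / 2"
  proof -
    have "L * \<delta> \<le> L * (1 / (2 * (L + 1)))" using L by (intro mult_left_mono) (auto simp: \<delta>_def)
    also have "\<dots> \<le> 1 / 2" using L by (simp add: field_simps)
    finally show ?thesis .
  qed
  define S where "S = (PiC UNIV (\<lambda>_. cball x0 r) :: (real \<Rightarrow>\<^sub>C 'a) set)"
  have memS: "z \<in> S \<longleftrightarrow> (\<forall>t. z t \<in> cball x0 r)" for z
    by (auto simp: S_def mem_PiC_iff)
  have contf: "continuous_on A (\<lambda>t. f (z t))" if "z \<in> S" for z A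
    by (rule continuous_on_compose2[OF lipschitz_on_continuous_on[OF lip]])
      (use that in \<open>auto simp: memS\<close>)
  have bound: "norm (integral {T..s} g) \<le> B * \<delta>"
    if "s \<in> {T..T+\<delta>}" "continuous_on {T..s} g" "\<And>t. norm (g t) \<le> B" for s B and g :: "real \<Rightarrow> 'a"
  proof -
    have "0 \<le> B" using that(3)[of 0] norm_ge_zero order_trans by blast
    have "norm (integral {T..s} g) \<le> B * (s - T)" using that by (intro integral_bound) auto
    also have "\<dots> \<le> B * \<delta>" using that \<open>0 \<le> B\<close> by (intro mult_left_mono) auto
    finally show ?thesis .
  qed
  \<comment> \<open>Clamping the upper limit freezes the integral outside
    \<open>{T..T+\<delta>}\<close>, so that the iterate is bounded and continuous on the whole
    line.\<close>
  have ex: "\<exists>w. \<forall>t. apply_bcontfun w t = x0 + integral {T..clamp T (T+\<delta>) t} (\<lambda>s. f (z s))" if "z \<in> S" for z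
  proof -
    have "continuous_on (cbox T (T+\<delta>)) (\<lambda>t. x0 + integral {T..t} (\<lambda>s. f (z s)))"
      unfolding cbox_interval
      by (intro continuous_intros indefinite_integral_continuous_1 integrable_continuous_interval contf that)
    then obtain w :: "real \<Rightarrow>\<^sub>C 'a" where
      "\<And>t. w t = x0 + integral {T..clamp T (T+\<delta>) t} (\<lambda>s. f (z s))"
      by (rule continuous_on_cbox_bcontfunE) blast
    then show ?thesis by blast
  qed
  then obtain P where P: "\<And>z t. z \<in> S \<Longrightarrow>
      apply_bcontfun (P z) t = x0 + integral {T..clamp T (T+\<delta>) t} (\<lambda>s. f (z s))"
    by metis
  have clamp: "clamp T (T+\<delta>) t \<in> {T..T+\<delta>}" for t
    using clamp_in_interval[of T "T+\<delta>" t] \<delta> by auto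
  have "\<exists>!z\<in>S. P z = z"
  proof (rule Banach_fix[where c = "1/2"])
    show "complete S" unfolding S_def by (simp add: complete_eq_closed closed_PiC)
    show "S \<noteq> {}"
    proof -
      have "const_bcontfun x0 \<in> S" using r by (auto simp: memS const_bcontfun.rep_eq)
      then show ?thesis by blast
    qed
    show "P ` S \<subseteq> S"
    proof safe
      fix z assume z: "z \<in> S"
      have "norm (integral {T..clamp T (T+\<delta>) t} (\<lambda>s. f (z s))) \<le> M * \<delta>" for t
        using z by (intro bound clamp contf fM) (auto simp: memS)
      then have "norm (integral {T..clamp T (T+\<delta>) t} (\<lambda>s. f (z s))) \<le> r" for t
        using M\<delta> order_trans by blast
      then show "P z \<in> S" by (simp add: memS P[OF z] dist_norm)
    qed
    show "dist (P z) (P w) \<le> 1/2 * dist z w" if z: "z \<in> S" and w: "w \<in> S" for z w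
    proof (rule dist_bound)
      fix t
      let ?s = "clamp T (T+\<delta>) t"
      have "dist (P z t) (P w t) = norm (integral {T..?s} (\<lambda>s. f (z s) - f (w s)))"
        by (simp add: P z w dist_norm integral_diff integrable_continuous_interval contf)
      also have "\<dots> \<le> (L * dist z w) * \<delta>"
      proof (intro bound clamp continuous_intros contf z w)
        fix s
        have "dist (f (z s)) (f (w s)) \<le> L * dist (z s) (w s)"
          using z w by (intro lipschitz_onD[OF lip]) (auto simp: memS)
        also have "\<dots> \<le> L * dist z w" by (intro mult_left_mono dist_bounded L)
        finally show "norm (f (z s) - f (w s)) \<le> L * dist z w" by (simp add: dist_norm)
      qed
      also have "\<dots> = (L * \<delta>) * dist z w" by simp
      also have "\<dots> \<le> 1/2 * dist z w" by (intro mult_right_mono L\<delta>) simp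
      finally show "dist (P z t) (P w t) \<le> 1/2 * dist z w" .
    qed
  qed auto
  then obtain z where z: "z \<in> S" "P z = z" by blast
  have zt: "z t = x0 + integral {T..t} (\<lambda>s. f (z s))" if "t \<in> {T..T+\<delta>}" for t
    using P[OF z(1), of t] z(2) that by simp
  show ?thesis
  proof
    show "\<delta> > 0" by fact
    show "z T = x0" using zt[of T] \<delta> by simp
    show "(z has_vector_derivative f (z t)) (at t within {T..T+\<delta>})" if "t \<in> {T..T+\<delta>}" for t
    proof (rule has_vector_derivative_transform[OF that zt])
      show "((\<lambda>t. x0 + integral {T..t} (\<lambda>s. f (z s))) has_vector_derivative f (z t)) (at t within {T..T+\<delta>})"
        by (rule derivative_eq_intros integral_has_vector_derivative contf z that | simp)+
    qed
  qed
qed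

text \<open>On a bounded trajectory the derivative is bounded, so \<open>X\<close> is Lipschitz and
  has a limit at \<open>T\<close>. The local solution started from that limit is glued on.\<close>

lemma bounded_solution_extends:
  fixes f :: "'a::euclidean_space \<Rightarrow> 'a"
  assumes lip: "\<And>R. \<exists>L. L-lipschitz_on (cball 0 R) f" and T: "0 < T"
    and sol: "\<And>t. t \<in> {0..<T} \<Longrightarrow> (X has_vector_derivative f (X t)) (at t within {0..<T})"
    and bdd: "\<And>t. t \<in> {0..<T} \<Longrightarrow> norm (X t) \<le> R"
  obtains T' Y where "T < T'" "\<And>t. t \<in> {0..<T} \<Longrightarrow> Y t = X t"
    "\<And>t. t \<in> {0..<T'} \<Longrightarrow> (Y has_vector_derivative f (Y t)) (at t within {0..<T'})"
proof -
  have contf: "continuous_on UNIV f"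
  proof (rule continuous_at_imp_continuous_on, rule ballI)
    fix x :: 'a
    obtain L where "L-lipschitz_on (cball 0 (norm x + 1)) f" using lip by blast
    then have "continuous_on (ball 0 (norm x + 1)) f"
      using lipschitz_on_continuous_on ball_subset_cball continuous_on_subset by blast
    then show "continuous (at x) f" by (rule continuous_on_interior) auto
  qed
  have "compact (f ` cball 0 R)"
    by (intro compact_continuous_image continuous_on_subset[OF contf]) auto
  then obtain M where M: "\<And>x. x \<in> cball 0 R \<Longrightarrow> norm (f x) \<le> M"
    using compact_imp_bounded bounded_iff by (metis imageI)
  have "M-lipschitz_on {0..<T} X"
  proof (rule bounded_derivative_imp_lipschitz)
    show "(X has_derivative (\<lambda>h. h *\<^sub>R f (X t))) (at t within {0..<T})" if "t \<in> {0..<T}" for t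
      using sol[OF that] by (simp add: has_vector_derivative_def)
    have "norm (f (X t)) \<le> M" if "t \<in> {0..<T}" for t using M bdd that by simp
    then show "onorm (\<lambda>h. h *\<^sub>R f (X t)) \<le> M" if "t \<in> {0..<T}" for t
      using that by (simp add: onorm_scaleR_left onorm_id)
    show "0 \<le> M" using order_trans[OF norm_ge_zero M[of "X 0"]] bdd[of 0] T by simp
  qed auto
  then have "uniformly_continuous_on {0..<T} X" by (rule lipschitz_on_uniformly_continuous)
  then obtain g where "uniformly_continuous_on (closure {0..<T}) g"
    and gX: "\<And>t. t \<in> {0..<T} \<Longrightarrow> X t = g t"
    using uniformly_continuous_on_extension_on_closure by metis
  then have contg: "continuous_on {0..T} g"
    using T by (simp add: uniformly_continuous_imp_continuous)
  obtain L where L: "L-lipschitz_on (cball 0 (norm (g T) + 1)) f" using lip by blast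
  have "L-lipschitz_on (cball (g T) 1) f"
    by (rule lipschitz_on_subset[OF L]) (auto simp: cball_subset_cball_iff)
  then obtain \<delta> y where \<delta>: "\<delta> > 0" and yT: "y T = g T"
    and y: "\<And>t. t \<in> {T..T+\<delta>} \<Longrightarrow> (y has_vector_derivative f (y t)) (at t within {T..T+\<delta>})"
    using picard_lindelof_forward[of L "g T" 1 f T] by auto
  define Y where "Y t = (if t \<le> T then g t else y t)" for t
  have "continuous_on {T..T+\<delta>} y"
    using y by (rule continuous_on_vector_derivative)
  then have contY: "continuous_on {0..T+\<delta>} Y"
  proof -
    assume "continuous_on {T..T+\<delta>} y"
    with contg have "continuous_on ({0..T} \<union> {T..T+\<delta>}) (\<lambda>t. if t \<le> T then g t else y t)"
      by (intro continuous_on_cases) (auto simp: yT)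
    moreover have "{0..T} \<union> {T..T+\<delta>} = {0..T+\<delta>}" using T \<delta> by auto
    ultimately show ?thesis by (simp add: Y_def[abs_def])
  qed
  have deriv: "(Y has_vector_derivative f (Y t)) (at t)" if t: "t \<in> {0<..<T+\<delta>} - {T}" for t
  proof (cases "t < T")
    case True
    have "(X has_vector_derivative f (X t)) (at t within {0<..<T})"
      using sol[of t] True t by (auto intro: has_vector_derivative_within_subset)
    then have "(X has_vector_derivative f (X t)) (at t)"
      using True t by (simp add: at_within_open[of t "{0<..<T}"])
    then have "(Y has_vector_derivative f (X t)) (at t)"
      by (rule has_vector_derivative_transform_within_open[of _ _ _ "{0<..<T}"])
        (use True t gX in \<open>auto simp: Y_def\<close>)
    then show ?thesis using True t gX by (simp add: Y_def)
  next
    case False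
    have "(y has_vector_derivative f (y t)) (at t within {T<..<T+\<delta>})"
      using y[of t] False t by (auto intro: has_vector_derivative_within_subset)
    then have "(y has_vector_derivative f (y t)) (at t)"
      using False t by (simp add: at_within_open[of t "{T<..<T+\<delta>}"])
    then have "(Y has_vector_derivative f (y t)) (at t)"
      by (rule has_vector_derivative_transform_within_open[of _ _ _ "{T<..<T+\<delta>}"])
        (use False t in \<open>auto simp: Y_def\<close>)
    then show ?thesis using False t by (simp add: Y_def)
  qed
  have contfY: "continuous_on {0..T+\<delta>} (\<lambda>t. f (Y t))"
    by (rule continuous_on_compose2[OF contf contY]) auto
  \<comment> \<open>Differentiability at the gluing point \<open>T\<close> is not checked directly.
    The fundamental theorem tolerates one exceptional point, and the resulting integral equation,
    whose integrand is continuous, yields the derivative everywhere, including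
    \<open>T\<close>.\<close>
  have Yint: "Y t = Y 0 + integral {0..t} (\<lambda>s. f (Y s))" if t: "t \<in> {0..T+\<delta>}" for t
  proof -
    have "((\<lambda>s. f (Y s)) has_integral (Y t - Y 0)) {0..t}"
      by (rule fundamental_theorem_of_calculus_interior_strong[of "{T}"])
        (use t deriv continuous_on_subset[OF contY] in auto)
    then show ?thesis by (simp add: integral_unique)
  qed
  show ?thesis
  proof
    show "T < T + \<delta>" using \<delta> by simp
    show "Y t = X t" if "t \<in> {0..<T}" for t using that gX by (simp add: Y_def)
    show "(Y has_vector_derivative f (Y t)) (at t within {0..<T+\<delta>})" if t: "t \<in> {0..<T+\<delta>}" for t
    proof -
      have t': "t \<in> {0..T+\<delta>}" using t by simp
      have int_deriv: "((\<lambda>t. Y 0 + integral {0..t} (\<lambda>s. f (Y s))) has_vector_derivative f (Y t)) (at t within {0..T+\<delta>})"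
        by (rule derivative_eq_intros integral_has_vector_derivative contfY t' | simp)+
      have "(Y has_vector_derivative f (Y t)) (at t within {0..T+\<delta>})"
        by (rule has_vector_derivative_transform[OF t' _ int_deriv]) (rule Yint)
      then show ?thesis by (rule has_vector_derivative_within_subset) auto
    qed
  qed
qed

section \<open>The system as one quadratic differential equation\<close>

text \<open>The polarized right-hand side: \<open>triple_prod x x\<close> is the vector field at
  \<open>x\<close>. Splitting the two factors makes it bilinear, which yields both the Lipschitz
  estimate on balls and the quadratic bound on its norm.\<close>

definition triple_prod ::
    "(real^'m) \<times> (real^'m^'m) \<times> (real^'m) \<Rightarrow> (real^'m) \<times> (real^'m^'m) \<times> (real^'m)
      \<Rightarrow> (real^'m) \<times> (real^'m^'m) \<times> (real^'m)" where
  "triple_prod x y = (fst (snd x) *v snd (snd y), outer_prod (fst x) (snd (snd y)),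
    transpose (fst (snd x)) *v fst y)"

lemma bounded_bilinear_triple_prod: "bounded_bilinear triple_prod"
proof -
  have "bilinear (triple_prod :: (real^'m) \<times> (real^'m^'m) \<times> (real^'m) \<Rightarrow> _)"
    unfolding bilinear_def linear_iff triple_prod_def outer_prod_def
    by (auto simp: vec_eq_iff algebra_simps matrix_vector_mult_def transpose_def
        sum.distrib sum_distrib_left)
  then show ?thesis by (simp add: bilinear_conv_bounded_bilinear)
qed

text \<open>Rests on the splitting \<open>B x x - B y y = B (x - y) x + B y (x - y)\<close>.\<close>

lemma quadratic_lipschitz_on_cball:
  fixes B :: "'a::real_normed_vector \<Rightarrow> 'a \<Rightarrow> 'b::real_normed_vector"
  assumes "bounded_bilinear B"
  shows "\<exists>L. L-lipschitz_on (cball 0 R) (\<lambda>x. B x x)"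
proof -
  interpret bounded_bilinear B by fact
  obtain K where K: "0 \<le> K" "\<And>x y. norm (B x y) \<le> norm x * norm y * K"
    using nonneg_bounded by blast
  \<comment> \<open>The absolute value keeps the constant nonnegative when \<open>R\<close> is
    negative and the ball is empty.\<close>
  have "(2 * \<bar>R\<bar> * K)-lipschitz_on (cball 0 R) (\<lambda>x. B x x)"
  proof (rule lipschitz_onI)
    fix x y :: 'a assume x: "x \<in> cball 0 R" and y: "y \<in> cball 0 R"
    have "dist (B x x) (B y y) = norm (B (x - y) x + B y (x - y))"
      by (simp add: dist_norm diff_left diff_right)
    also have "\<dots> \<le> norm (x - y) * norm x * K + norm y * norm (x - y) * K"
      by (intro norm_triangle_le add_mono K)
    also have "\<dots> = (norm x + norm y) * (norm (x - y) * K)"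
      by (simp add: algebra_simps)
    also have "\<dots> \<le> (2 * \<bar>R\<bar>) * (norm (x - y) * K)"
      using x y K by (intro mult_right_mono) auto
    finally show "dist (B x x) (B y y) \<le> 2 * \<bar>R\<bar> * K * dist x y"
      by (simp add: dist_norm algebra_simps)
  qed (use K in auto)
  then show ?thesis by blast
qed

text \<open>Packs the three equations into a single autonomous one, the form to which
  \<open>bounded_solution_extends\<close> applies.\<close>

lemma is_solution_iff_triple_prod:
  "is_solution a b c T \<longleftrightarrow> (\<forall>t \<in> forward_interval T.
     ((\<lambda>t. (a t, b t, c t)) has_vector_derivative
        triple_prod (a t, b t, c t) (a t, b t, c t)) (at t within forward_interval T))"
  (is "_ \<longleftrightarrow> (\<forall>t\<in>_. ?D t)")
proof -
  have "?D t \<longleftrightarrow>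
     (a has_vector_derivative (b t *v c t)) (at t within forward_interval T) \<and>
     (b has_vector_derivative (outer_prod (a t) (c t))) (at t within forward_interval T) \<and>
     (c has_vector_derivative (transpose (b t) *v a t)) (at t within forward_interval T)" for t
  proof (intro iffI conjI)
    assume D: "?D t"
    note D1 = bounded_linear.has_vector_derivative[OF bounded_linear_fst D]
    note D2 = bounded_linear.has_vector_derivative[OF bounded_linear_snd D]
    show "(a has_vector_derivative (b t *v c t)) (at t within forward_interval T)"
      using D1 by (simp add: triple_prod_def)
    show "(b has_vector_derivative (outer_prod (a t) (c t))) (at t within forward_interval T)"
      using bounded_linear.has_vector_derivative[OF bounded_linear_fst D2] by (simp add: triple_prod_def)
    show "(c has_vector_derivative (transpose (b t) *v a t)) (at t within forward_interval T)"
      using bounded_linear.has_vector_derivative[OF bounded_linear_snd D2] by (simp add: triple_prod_def)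
  qed (auto simp: triple_prod_def intro!: has_vector_derivative_Pair)
  then show ?thesis unfolding is_solution_def by blast
qed

lemma forward_interval_ereal: "forward_interval (ereal T) = {0..<T}"
  by (auto simp: forward_interval_def)

section \<open>Derivatives and conserved quantities along the flow\<close>

text \<open>Exhibits the energy as the Frobenius product of \<open>b\<close> with its own time
  derivative.\<close>

lemma inner_outer_prod: "(b :: real^'m^'m) \<bullet> outer_prod x y = x \<bullet> (b *v y)"
  by (simp add: inner_vec_def outer_prod_def matrix_vector_mult_def sum_distrib_left ac_simps)

lemma norm_outer_prod: "norm (outer_prod x y) = norm x * norm (y :: real^'m)"
proof -
  have "outer_prod x y *v y = (y \<bullet> y) *\<^sub>R x"
    by (simp add: vec_eq_iff outer_prod_def matrix_vector_mult_def inner_vec_def sum_distrib_left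
        sum_distrib_right ac_simps)
  then have "outer_prod x y \<bullet> outer_prod x y = (x \<bullet> x) * (y \<bullet> y)"
    by (simp add: inner_outer_prod)
  then show ?thesis by (simp add: norm_eq_sqrt_inner real_sqrt_mult)
qed

lemma bounded_linear_column: "bounded_linear (column i :: real^'m^'n \<Rightarrow> _)"
  unfolding linear_conv_bounded_linear[symmetric]
  by (auto simp: linear_iff column_def vec_eq_iff)

lemma bounded_bilinear_matrix_vector_mult: "bounded_bilinear ((*v) :: real^'m^'n \<Rightarrow> _)"
proof -
  have "bilinear ((*v) :: real^'m^'n \<Rightarrow> _)"
    unfolding bilinear_def linear_iff
    by (auto simp: algebra_simps scaleR_matrix_vector_assoc)
  then show ?thesis by (simp add: bilinear_conv_bounded_bilinear)
qed

context
  fixes a c :: "real \<Rightarrow> real ^ 'm" and b :: "real \<Rightarrow> real ^ 'm ^ 'm" and T :: ereal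
  assumes sol: "is_solution a b c T"
begin

lemma
  assumes "t \<in> forward_interval T"
  shows deriv_a: "(a has_vector_derivative (b t *v c t)) (at t within forward_interval T)"
    and deriv_b: "(b has_vector_derivative (outer_prod (a t) (c t))) (at t within forward_interval T)"
    and deriv_c: "(c has_vector_derivative (transpose (b t) *v a t)) (at t within forward_interval T)"
  using sol assms unfolding is_solution_def by blast+

text \<open>The energy is linear in each variable, and the derivative of each variable is the
  gradient of the energy in that variable. Pairing a variable with its partial gradient therefore
  returns the energy, the same value for all three.\<close>

lemma deriv_squared_norms:
  assumes "t \<in> forward_interval T"
  shows "((\<lambda>t. a t \<bullet> a t) has_vector_derivative 2 * energy (a t) (b t) (c t))
      (at t within forward_interval T)"
    and "((\<lambda>t. b t \<bullet> b t) has_vector_derivative 2 * energy (a t) (b t) (c t))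
      (at t within forward_interval T)"
    and "((\<lambda>t. c t \<bullet> c t) has_vector_derivative 2 * energy (a t) (b t) (c t))
      (at t within forward_interval T)"
proof -
  note inner = bounded_bilinear.has_vector_derivative[OF bounded_bilinear_inner]
  show "((\<lambda>t. a t \<bullet> a t) has_vector_derivative 2 * energy (a t) (b t) (c t))
      (at t within forward_interval T)"
    using inner[OF deriv_a[OF assms] deriv_a[OF assms]]
    by (simp add: energy_def inner_commute)
  show "((\<lambda>t. b t \<bullet> b t) has_vector_derivative 2 * energy (a t) (b t) (c t))
      (at t within forward_interval T)"
    using inner[OF deriv_b[OF assms] deriv_b[OF assms]]
    by (simp add: energy_def inner_outer_prod inner_commute[of "outer_prod _ _"])
  show "((\<lambda>t. c t \<bullet> c t) has_vector_derivative 2 * energy (a t) (b t) (c t))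
      (at t within forward_interval T)"
    using inner[OF deriv_c[OF assms] deriv_c[OF assms]]
    by (simp add: energy_def dot_lmul_matrix inner_commute[of "c t"])
qed

text \<open>The system is the gradient ascent flow of the energy, so the energy grows at the rate of
  the squared norm of its gradient. The three terms of the product rule are the squared norms of the
  three components of the vector field.\<close>

lemma deriv_energy:
  assumes "t \<in> forward_interval T"
  shows "((\<lambda>t. energy (a t) (b t) (c t)) has_vector_derivative
    (norm (triple_prod (a t, b t, c t) (a t, b t, c t)))\<^sup>2) (at t within forward_interval T)"
proof -
  note inner = bounded_bilinear.has_vector_derivative[OF bounded_bilinear_inner]
  note mult = bounded_bilinear.has_vector_derivative[OF bounded_bilinear_matrix_vector_mult]
  have "outer_prod (a t) (c t) *v c t = (c t \<bullet> c t) *\<^sub>R a t"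
    by (simp add: vec_eq_iff outer_prod_def matrix_vector_mult_def inner_vec_def
        sum_distrib_left sum_distrib_right ac_simps)
  then have "energy (a t) (outer_prod (a t) (c t)) (c t) = (norm (outer_prod (a t) (c t)))\<^sup>2"
    by (simp add: energy_def norm_outer_prod power_mult_distrib power2_norm_eq_inner)
  moreover have "energy (a t) (b t) (transpose (b t) *v a t) = (norm (transpose (b t) *v a t))\<^sup>2"
    by (simp add: energy_def power2_norm_eq_inner flip: dot_lmul_matrix)
  ultimately have "(norm (triple_prod (a t, b t, c t) (a t, b t, c t)))\<^sup>2 =
      a t \<bullet> (outer_prod (a t) (c t) *v c t + b t *v (transpose (b t) *v a t)) + (b t *v c t) \<bullet> (b t *v c t)"
    by (simp add: triple_prod_def norm_Pair energy_def inner_add_right power2_norm_eq_inner[of "b t *v c t"]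
        del: transpose_matrix_vector)
  then show ?thesis
    using inner[OF deriv_a[OF assms] mult[OF deriv_b[OF assms] deriv_c[OF assms]]]
    by (simp add: energy_def ac_simps)
qed

lemma constant_if_deriv_zero:
  assumes "\<And>t. t \<in> forward_interval T \<Longrightarrow>
    (f has_vector_derivative (0::real)) (at t within forward_interval T)"
  shows "\<exists>k. \<forall>t\<in>forward_interval T. f t = k"
proof -
  have "convex (forward_interval T)"
    by (intro is_interval_convex)
      (auto simp: is_interval_1 forward_interval_def intro: le_less_trans[rotated])
  then show ?thesis
    using has_vector_derivative_zero_constant[of "forward_interval T" f] assms by metis
qed

lemma conserved_norms:
  obtains \<beta> \<gamma> where "\<And>t. t \<in> forward_interval T \<Longrightarrow> b t \<bullet> b t = a t \<bullet> a t + \<beta>"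
    "\<And>t. t \<in> forward_interval T \<Longrightarrow> c t \<bullet> c t = a t \<bullet> a t + \<gamma>"
proof -
  have "\<exists>\<beta>. \<forall>t\<in>forward_interval T. b t \<bullet> b t - a t \<bullet> a t = \<beta>"
    by (rule constant_if_deriv_zero)
      (use has_vector_derivative_diff[OF deriv_squared_norms(2,1)] in simp)
  moreover have "\<exists>\<gamma>. \<forall>t\<in>forward_interval T. c t \<bullet> c t - a t \<bullet> a t = \<gamma>"
    by (rule constant_if_deriv_zero)
      (use has_vector_derivative_diff[OF deriv_squared_norms(3,1)] in simp)
  ultimately show ?thesis by (metis that diff_add_cancel add.commute)
qed

text \<open>Column \<open>i\<close> of \<open>b\<close> has derivative
  \<open>c $ i *\<^sub>R a\<close>, and \<open>c $ i\<close> has derivative the inner product of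
  that column with \<open>a\<close>. The product rule then gives the same derivative for the Gram
  entry and for \<open>c $ i * c $ j\<close>.\<close>

lemma conserved_columns:
  obtains k where "\<And>t i j. t \<in> forward_interval T \<Longrightarrow>
    column i (b t) \<bullet> column j (b t) = c t $ i * c t $ j + k i j"
proof -
  note inner = bounded_bilinear.has_vector_derivative[OF bounded_bilinear_inner]
  have "\<exists>k. \<forall>t\<in>forward_interval T. column i (b t) \<bullet> column j (b t) - c t $ i * c t $ j = k" for i j
  proof (rule constant_if_deriv_zero)
    fix t assume t: "t \<in> forward_interval T"
    have col: "((\<lambda>t. column i (b t)) has_vector_derivative (c t $ i) *\<^sub>R a t)
        (at t within forward_interval T)" for i
    proof -
      have "column i (outer_prod (a t) (c t)) = (c t $ i) *\<^sub>R a t"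
        by (simp add: vec_eq_iff column_def outer_prod_def)
      then show ?thesis
        using bounded_linear.has_vector_derivative[OF bounded_linear_column deriv_b[OF t], of i]
        by simp
    qed
    have comp: "((\<lambda>t. c t $ i) has_vector_derivative column i (b t) \<bullet> a t)
        (at t within forward_interval T)" for i
    proof -
      have "(transpose (b t) *v a t) $ i = column i (b t) \<bullet> a t"
        unfolding matrix_vector_mult_def by (simp add: column_def transpose_def inner_vec_def)
      then show ?thesis
        using bounded_linear.has_vector_derivative[OF bounded_linear_vec_nth deriv_c[OF t], of i]
        by metis
    qed
    show "((\<lambda>t. column i (b t) \<bullet> column j (b t) - c t $ i * c t $ j) has_vector_derivative 0)
        (at t within forward_interval T)"
      using has_vector_derivative_diff[OF inner[OF col col]
          bounded_bilinear.has_vector_derivative[OF bounded_bilinear_mult comp comp], of i j i j]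
      by (simp add: inner_commute algebra_simps)
  qed
  then obtain k where "\<And>i j t. t\<in>forward_interval T \<Longrightarrow>
      column i (b t) \<bullet> column j (b t) - c t $ i * c t $ j = k i j"
    by metis
  then show ?thesis by (intro that[of k]) (metis diff_add_cancel add.commute)
qed

end

section \<open>Inequalities for fixed vectors and for scalar functions\<close>

text \<open>The squared norm is the quadratic form of the Gram matrix at \<open>c\<close>. Its
  rank-one part contributes the fourth power of the norm of \<open>c\<close>; the remainder
  \<open>k\<close> costs at most the sum of its absolute entries times \<open>c \<bullet> c\<close>,
  since each entry of \<open>c\<close> is bounded by its norm.\<close>

lemma norm_matrix_vector_lower_bound:
  fixes b :: "real^'m^'n"
  assumes k: "\<And>i j. column i b \<bullet> column j b = c $ i * c $ j + k i j"
  shows "(c \<bullet> c) * (c \<bullet> c) - (\<Sum>i\<in>UNIV. \<Sum>j\<in>UNIV. \<bar>k i j\<bar>) * (c \<bullet> c) \<le> (norm (b *v c))\<^sup>2"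
proof -
  have "(norm (b *v c))\<^sup>2 = (\<Sum>i\<in>UNIV. \<Sum>j\<in>UNIV. c $ i * c $ j * (column i b \<bullet> column j b))"
    by (simp add: power2_norm_eq_inner matrix_mult_sum inner_sum_left inner_sum_right
        scalar_mult_eq_scaleR sum_distrib_left inner_commute ac_simps)
  also have "\<dots> = (\<Sum>i\<in>UNIV. \<Sum>j\<in>UNIV. (c $ i * c $ i) * (c $ j * c $ j) + c $ i * c $ j * k i j)"
    by (simp add: k algebra_simps)
  also have "\<dots> = (c \<bullet> c) * (c \<bullet> c) + (\<Sum>i\<in>UNIV. \<Sum>j\<in>UNIV. c $ i * c $ j * k i j)"
    by (simp add: sum.distrib inner_vec_def sum_product)
  finally have eq: "(norm (b *v c))\<^sup>2 = \<dots>" .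
  have "c $ i * c $ j * k i j \<ge> - (\<bar>k i j\<bar> * (c \<bullet> c))" for i j
  proof -
    have "\<bar>c $ i * c $ j * k i j\<bar> = \<bar>k i j\<bar> * (\<bar>c $ i\<bar> * \<bar>c $ j\<bar>)"
      by (simp add: abs_mult)
    also have "\<dots> \<le> \<bar>k i j\<bar> * (norm c * norm c)"
      by (intro mult_left_mono mult_mono component_le_norm_cart) auto
    finally show ?thesis by (simp add: power2_norm_eq_inner flip: power2_eq_square)
  qed
  then have "(\<Sum>i\<in>UNIV. \<Sum>j\<in>UNIV. c $ i * c $ j * k i j) \<ge>
      (\<Sum>i\<in>UNIV. \<Sum>j\<in>UNIV. - (\<bar>k i j\<bar> * (c \<bullet> c)))"
    by (intro sum_mono)
  then show ?thesis using eq by (simp add: sum_negf sum_distrib_right)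
qed

text \<open>By Cauchy-Schwarz the quotient lies in the range where \<open>cos\<close> inverts
  \<open>arccos\<close>. If a vector vanishes, both sides are zero, so the conventional angle
  \<open>pi / 2\<close> does no harm.\<close>

lemma inner_ge_if_cos_vec_angle_ge:
  assumes "k \<le> cos (vec_angle x y)"
  shows "k * (norm x * norm y) \<le> x \<bullet> y"
proof (cases "norm x * norm y = 0")
  case True
  then show ?thesis by auto
next
  case False
  then have pos: "norm x * norm y > 0" by simp
  have le1: "\<bar>x \<bullet> y / (norm x * norm y)\<bar> \<le> 1"
    using Cauchy_Schwarz_ineq2[of x y] pos by (simp add: abs_divide divide_le_eq_1)
  have "cos (vec_angle x y) = x \<bullet> y / (norm x * norm y)"
    unfolding vec_angle_def by (rule cos_arccos) (use le1 in linarith)+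
  then show ?thesis using assms pos by (simp add: pos_le_divide_eq)
qed

text \<open>Differentiating the power \<open>- 1 / 3\<close> turns the growth bound into a constant:
  the exponents \<open>- 4 / 3\<close> and \<open>4 / 3\<close> cancel, and the factor 3 absorbs the
  factor 1/3.\<close>

lemma powr_neg_third_decrease:
  fixes E E' :: "real \<Rightarrow> real"
  assumes "s \<le> t"
    and deriv: "\<And>u. s \<le> u \<Longrightarrow> u \<le> t \<Longrightarrow> (E has_real_derivative E' u) (at u)"
    and pos: "\<And>u. s \<le> u \<Longrightarrow> u \<le> t \<Longrightarrow> 0 < E u"
    and bound: "\<And>u. s \<le> u \<Longrightarrow> u \<le> t \<Longrightarrow> E' u \<le> 3 * C * E u powr (4 / 3)"
  shows "E s powr (- 1 / 3) - C * (t - s) \<le> E t powr (- 1 / 3)"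
proof -
  have "E s powr (- 1 / 3) + C * s \<le> E t powr (- 1 / 3) + C * t"
  proof (rule DERIV_nonneg_imp_nondecreasing[OF \<open>s \<le> t\<close>])
    fix u assume u: "s \<le> u" "u \<le> t"
    have "((\<lambda>u. E u powr (- 1 / 3)) has_real_derivative
        (- 1 / 3) * E u powr (- 1 / 3 - of_nat 1) * E' u) (at u)"
      by (intro DERIV_fun_powr deriv pos u)
    from DERIV_add[OF this DERIV_cmult_Id[of C]]
    have D: "((\<lambda>u. E u powr (- 1 / 3) + C * u) has_real_derivative
        (- 1 / 3) * E u powr (- (4 / 3)) * E' u + C) (at u)"
      by simp
    have "E u powr (- (4 / 3)) * E' u \<le> E u powr (- (4 / 3)) * (3 * C * E u powr (4 / 3))"
      by (intro mult_left_mono bound u) auto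
    also have "\<dots> = 3 * C" using pos[OF u] by (simp add: powr_minus)
    finally show "\<exists>y. ((\<lambda>u. E u powr (- 1 / 3) + C * u) has_real_derivative y) (at u) \<and> 0 \<le> y"
      using D by (intro exI[of _ "(- 1 / 3) * E u powr (- (4 / 3)) * E' u + C"]) auto
  qed
  then show ?thesis by (simp add: algebra_simps)
qed

lemma le_inverse_cube_if_powr_neg_third_ge:
  fixes x y :: real
  assumes "0 < x" "x \<le> y powr (- 1 / 3)" "0 < y"
  shows "y \<le> 1 / x ^ 3"
proof -
  have "x ^ 3 \<le> (y powr (- 1 / 3)) ^ 3" using assms by (intro power_mono) auto
  also have "\<dots> = (y powr (- 1 / 3)) powr real 3"
    using assms by (intro powr_realpow[symmetric]) auto
  also have "\<dots> = 1 / y"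
    using assms unfolding powr_powr by (simp add: powr_minus_divide)
  finally show ?thesis using assms by (simp add: field_simps)
qed

section \<open>Unbounded growth of maximal solutions\<close>

text \<open>Otherwise \<open>bounded_solution_extends\<close> would continue the solution past the
  finite time \<open>T\<close>, against maximality.\<close>

lemma maximal_solution_unbounded:
  fixes a c :: "real \<Rightarrow> real ^ 'm" and b :: "real \<Rightarrow> real ^ 'm ^ 'm"
  assumes max: "is_maximal_solution a b c (ereal T)"
  shows "\<exists>t\<in>{0..<T}. R < norm (a t, b t, c t)"
proof (rule ccontr)
  assume "\<not> ?thesis"
  then have bdd: "norm (a t, b t, c t) \<le> R" if "t \<in> {0..<T}" for t using that by force
  have T: "0 < T" and sol: "is_solution a b c (ereal T)"
    using max by (auto simp: is_maximal_solution_def)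
  have lip: "\<exists>L. L-lipschitz_on (cball 0 r) (\<lambda>x :: (real^'m) \<times> (real^'m^'m) \<times> (real^'m). triple_prod x x)" for r
    by (rule quadratic_lipschitz_on_cball[OF bounded_bilinear_triple_prod])
  have deriv: "((\<lambda>t. (a t, b t, c t)) has_vector_derivative
      triple_prod (a t, b t, c t) (a t, b t, c t)) (at t within {0..<T})" if "t \<in> {0..<T}" for t
    using sol that by (simp add: is_solution_iff_triple_prod forward_interval_ereal)
  obtain T' Y where T': "T < T'" and YX: "\<And>t. t \<in> {0..<T} \<Longrightarrow> Y t = (a t, b t, c t)"
    and Y: "\<And>t. t \<in> {0..<T'} \<Longrightarrow> (Y has_vector_derivative triple_prod (Y t) (Y t)) (at t within {0..<T'})"
    by (rule bounded_solution_extends[OF lip T deriv bdd]) (assumption | rule that)+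
  define a' b' c' where "a' t = fst (Y t)" and "b' t = fst (snd (Y t))" and "c' t = snd (snd (Y t))" for t
  have "is_solution a' b' c' (ereal T')"
    using Y by (simp add: is_solution_iff_triple_prod forward_interval_ereal a'_def b'_def c'_def)
  moreover have "\<forall>t\<in>forward_interval (ereal T). a' t = a t \<and> b' t = b t \<and> c' t = c t"
    using YX by (simp add: forward_interval_ereal a'_def b'_def c'_def)
  ultimately show False
    using max T' unfolding is_maximal_solution_def less_ereal.simps(1)[symmetric] by blast
qed

lemma has_vector_derivative_interior_forward_interval:
  assumes "(f has_vector_derivative D) (at t within forward_interval T)" "0 < t" "ereal t < T"
  shows "(f has_vector_derivative D) (at t)"
proof -
  \<comment> \<open>A real number strictly between \<open>t\<close> and \<open>T\<close> provides an
    open real neighbourhood of \<open>t\<close> even when \<open>T\<close> is infinite.\<close>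
  obtain u where u: "ereal t < ereal u" "ereal u < T"
    using assms(3) by (metis ereal_dense2)
  then have "{0<..<u} \<subseteq> forward_interval T"
    by (auto simp: forward_interval_def) (meson ereal_less_eq(3) less_imp_le order_le_less_trans)
  then have "(f has_vector_derivative D) (at t within {0<..<u})"
    using assms(1) has_vector_derivative_within_subset by blast
  then show ?thesis using assms u by (simp add: at_within_open[of t "{0<..<u}"])
qed

text \<open>At \<open>s = 0\<close> only a one-sided derivative exists, so monotonicity of
  \<open>f u - m * u\<close> is derived from two-sided derivatives inside the interval and
  continuity up to its ends.\<close>

lemma growth_on_forward_interval:
  fixes f :: "real \<Rightarrow> real"
  assumes deriv: "\<And>t. t \<in> forward_interval T \<Longrightarrow>
      (f has_vector_derivative f' t) (at t within forward_interval T)"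
    and ge: "\<And>u. s < u \<Longrightarrow> u < t \<Longrightarrow> m \<le> f' u"
    and st: "0 \<le> s" "s \<le> t" "ereal t < T"
  shows "f s + m * (t - s) \<le> f t"
proof -
  have mem: "u \<in> forward_interval T" if "s \<le> u" "u \<le> t" for u
    using that st by (auto simp: forward_interval_def intro: le_less_trans[of _ "ereal t"])
  have "f s - m * s \<le> f t - m * t"
  proof (rule DERIV_nonneg_imp_increasing_open[OF \<open>s \<le> t\<close>])
    show "\<exists>y. ((\<lambda>u. f u - m * u) has_real_derivative y) (at u) \<and> 0 \<le> y" if u: "s < u" "u < t" for u
    proof -
      have "ereal u < T" using mem[of u] u by (simp add: forward_interval_def)
      then have "(f has_real_derivative f' u) (at u)"
        using has_vector_derivative_interior_forward_interval[OF deriv[OF mem]] u st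
        by (simp add: has_real_derivative_iff_has_vector_derivative)
      from DERIV_diff[OF this DERIV_cmult_Id[of m]] show ?thesis using ge[OF u] by force
    qed
    have "continuous_on (forward_interval T) f"
      using deriv by (rule continuous_on_vector_derivative)
    then have "continuous_on {s..t} f" by (rule continuous_on_subset) (use mem in auto)
    then show "continuous_on {s..t} (\<lambda>u. f u - m * u)" by (intro continuous_intros)
  qed
  then show ?thesis by (simp add: algebra_simps)
qed

text \<open>Row by row, the energy is a sum of the terms that the first half of the condition makes
  positive.\<close>

lemma final_stage_energy_pos:
  assumes "final_stage a b c"
  shows "0 < energy a b c"
proof -
  have "energy a b c = (\<Sum>i\<in>UNIV. a $ i * (row i b \<bullet> c))"
    by (simp add: energy_def inner_vec_def matrix_vector_mult_def row_def)
  also have "\<dots> > 0" using assms by (intro sum_pos) (auto simp: final_stage_def)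
  finally show ?thesis .
qed

lemma energy_mono:
  assumes "is_solution a b c T" "0 \<le> s" "s \<le> t" "ereal t < T"
  shows "energy (a s) (b s) (c s) \<le> energy (a t) (b t) (c t)"
  using growth_on_forward_interval[OF deriv_energy[OF assms(1)], of s t 0] assms by simp

text \<open>Serves twice: with positive energy it forces linear growth when the time is unlimited,
  and it preserves any lower bound on the norm of \<open>a\<close> once reached.\<close>

lemma squared_norm_growth:
  assumes sol: "is_solution a b c T" and st: "0 \<le> s" "s \<le> t" "ereal t < T"
  shows "a s \<bullet> a s + 2 * energy (a s) (b s) (c s) * (t - s) \<le> a t \<bullet> a t"
proof (rule growth_on_forward_interval[OF deriv_squared_norms(1)[OF sol] _ st])
  fix u assume u: "s < u" "u < t"
  then have "ereal u < T" using st by (metis less_ereal.simps(1) less_trans)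
  then show "2 * energy (a s) (b s) (c s) \<le> 2 * energy (a u) (b u) (c u)"
    using energy_mono[OF sol, of s u] u st by simp
qed

text \<open>For infinite \<open>T\<close> linear growth suffices. For finite \<open>T\<close> the
  whole state is unbounded; it is bounded on the compact interval up to \<open>t0\<close>, and
  afterwards the conserved norms transfer its growth to \<open>a\<close>.\<close>

lemma squared_norm_unbounded:
  fixes a c :: "real \<Rightarrow> real ^ 'm" and b :: "real \<Rightarrow> real ^ 'm ^ 'm"
  assumes max: "is_maximal_solution a b c T" and t0: "0 \<le> t0" "ereal t0 < T"
    and E0: "0 < energy (a t0) (b t0) (c t0)"
  shows "\<exists>t. t0 \<le> t \<and> ereal t < T \<and> R \<le> a t \<bullet> a t"
proof (cases "T = \<infinity>")
  case True
  have sol: "is_solution a b c T" using max by (simp add: is_maximal_solution_def)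
  \<comment> \<open>The waiting time after which linear growth has added at least the absolute value
    of \<open>R\<close>.\<close>
  define t where "t = t0 + \<bar>R\<bar> / (2 * energy (a t0) (b t0) (c t0))"
  have t: "t0 \<le> t" using E0 by (simp add: t_def)
  have "2 * energy (a t0) (b t0) (c t0) * (t - t0) = \<bar>R\<bar>" using E0 by (simp add: t_def)
  with squared_norm_growth[OF sol t0(1) t] True have "a t0 \<bullet> a t0 + \<bar>R\<bar> \<le> a t \<bullet> a t" by simp
  then have "R \<le> a t \<bullet> a t" using inner_ge_zero[of "a t0"] by linarith
  then show ?thesis using t True by auto
next
  case False
  then obtain r where T: "T = ereal r" using t0 by (cases T) auto
  have sol: "is_solution a b c T" using max by (simp add: is_maximal_solution_def)
  have r: "t0 < r" using t0 T by simp
  show ?thesis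
  proof (rule ccontr)
    assume "\<not> ?thesis"
    then have bdd: "a t \<bullet> a t < R" if "t0 \<le> t" "t < r" for t using that T by force
    obtain \<beta> \<gamma> where \<beta>: "\<And>t. t \<in> forward_interval T \<Longrightarrow> b t \<bullet> b t = a t \<bullet> a t + \<beta>"
      and \<gamma>: "\<And>t. t \<in> forward_interval T \<Longrightarrow> c t \<bullet> c t = a t \<bullet> a t + \<gamma>"
      using conserved_norms[OF sol] by blast
    have "continuous_on (forward_interval T) (\<lambda>t. (a t, b t, c t))"
      using sol unfolding is_solution_iff_triple_prod
      by (intro continuous_on_vector_derivative) blast
    then have "continuous_on {0..t0} (\<lambda>t. (a t, b t, c t))"
      by (rule continuous_on_subset) (use r T in \<open>auto simp: forward_interval_ereal\<close>)
    then have "bounded ((\<lambda>t. (a t, b t, c t)) ` {0..t0})"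
      by (intro compact_imp_bounded compact_continuous_image) auto
    then obtain M where "\<forall>x\<in>(\<lambda>t. (a t, b t, c t)) ` {0..t0}. norm x \<le> M"
      unfolding bounded_iff by blast
    then have M: "norm (a t, b t, c t) \<le> M" if "t \<in> {0..t0}" for t using that by simp
    \<comment> \<open>Exceeding \<open>M\<close> forces \<open>t\<close> beyond \<open>t0\<close>.
      Exceeding the root forces \<open>a t \<bullet> a t\<close> above \<open>R\<close>, because the
      squared norm of the state is \<open>3 * (a t \<bullet> a t) + \<beta> + \<gamma>\<close>;
      \<open>sqrt\<close> is strictly increasing on all reals, so the sign of the radicand does not
      matter.\<close>
    obtain t where t: "t \<in> {0..<r}" "max M (sqrt (3 * R + \<beta> + \<gamma>)) < norm (a t, b t, c t)"
      using maximal_solution_unbounded[OF max[unfolded T], of "max M (sqrt (3 * R + \<beta> + \<gamma>))"] by blast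
    have mem: "t \<in> forward_interval T" using t T by (simp add: forward_interval_ereal)
    have "norm (a t, b t, c t) = sqrt (3 * (a t \<bullet> a t) + \<beta> + \<gamma>)"
      using \<beta>[OF mem] \<gamma>[OF mem] by (simp add: norm_eq_sqrt_inner)
    then have "R < a t \<bullet> a t" using t by simp
    moreover have "t0 \<le> t" using M[of t] t by (cases "t0 \<le> t") auto
    ultimately show False using bdd[of t] t by simp
  qed
qed

section \<open>Comparison of the energy with the norm of \<open>a\<close>\<close>

text \<open>For large \<open>a\<close> the conserved quantities become negligible:
  \<open>b *v c\<close> is at least of order two in the norm of \<open>a\<close>, and the angle
  condition makes the energy at least of order three. The squared vector field is at most of order
  four, so eliminating the norm of \<open>a\<close> leaves the exponent
  \<open>4 / 3\<close>.\<close>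

lemma energy_bounds_if_norm_large:
  fixes a c :: "real^'m" and b :: "real^'m^'m"
  assumes \<beta>: "b \<bullet> b = a \<bullet> a + \<beta>" and \<gamma>: "c \<bullet> c = a \<bullet> a + \<gamma>"
    and k: "\<And>i j. column i b \<bullet> column j b = c $ i * c $ j + k i j"
    and large: "1 + \<bar>\<beta>\<bar> + 2 * \<bar>\<gamma>\<bar> + 4 * (\<Sum>i\<in>UNIV. \<Sum>j\<in>UNIV. \<bar>k i j\<bar>) \<le> a \<bullet> a"
    and \<theta>: "0 < \<theta>" "\<theta> * (norm a * norm (b *v c)) \<le> energy a b c"
    and K: "norm (triple_prod (a, b, c) (a, b, c)) \<le> norm (a, b, c) * norm (a, b, c) * K"
  shows "\<theta> / 3 * norm a ^ 3 \<le> energy a b c"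
    and "(norm (triple_prod (a, b, c) (a, b, c)))\<^sup>2
      \<le> 16 * K\<^sup>2 * (3 / \<theta>) powr (4 / 3) * energy a b c powr (4 / 3)"
proof -
  define \<kappa> where "\<kappa> = (\<Sum>i\<in>UNIV. \<Sum>j\<in>UNIV. \<bar>k i j\<bar>)"
  have \<kappa>: "0 \<le> \<kappa>" by (simp add: \<kappa>_def sum_nonneg)
  define n where "n = a \<bullet> a"
  have n: "n = (norm a)\<^sup>2" by (simp add: n_def power2_norm_eq_inner)
  have large': "1 + \<bar>\<beta>\<bar> + 2 * \<bar>\<gamma>\<bar> + 4 * \<kappa> \<le> n" using large by (simp add: n_def \<kappa>_def)
  \<comment> \<open>The size assumption gives \<open>c \<bullet> c \<ge> n / 2\<close> and
    \<open>c \<bullet> c - \<kappa> \<ge> n / 4\<close>; lowering 1/8 to 1/9 produces a perfect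
    square.\<close>
  have "(n / 3)\<^sup>2 \<le> (n / 2) * (n / 4)"
    by (simp add: power2_eq_square)
  also have "\<dots> \<le> (c \<bullet> c) * (c \<bullet> c - \<kappa>)"
    using large' \<kappa> \<gamma> by (intro mult_mono) (auto simp: n_def[symmetric])
  also have "\<dots> \<le> (norm (b *v c))\<^sup>2"
    using norm_matrix_vector_lower_bound[OF k] by (simp add: \<kappa>_def algebra_simps)
  finally have bc: "n / 3 \<le> norm (b *v c)" by (rule power2_le_imp_le) simp
  have "\<theta> / 3 * norm a ^ 3 = \<theta> * (norm a * (n / 3))"
    by (simp add: n power2_eq_square power3_eq_cube)
  also have "\<dots> \<le> \<theta> * (norm a * norm (b *v c))"
    using \<theta> bc by (intro mult_left_mono) auto
  also note \<theta>(2)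
  finally show E: "\<theta> / 3 * norm a ^ 3 \<le> energy a b c" .
  then have cube: "norm a ^ 3 \<le> 3 / \<theta> * energy a b c" using \<theta> by (simp add: field_simps)
  have a: "norm a > 0" using large' \<kappa> n by (cases "norm a = 0") auto
  have sq: "norm (a, b, c) * norm (a, b, c) = 3 * n + \<beta> + \<gamma>"
    using \<beta> \<gamma> by (simp add: power2_norm_eq_inner n_def flip: power2_eq_square)
  \<comment> \<open>The constants \<open>\<beta>\<close> and \<open>\<gamma>\<close> together amount
    to at most one further \<open>n\<close>; squaring the 4 yields the factor 16.\<close>
  have le4n: "norm (a, b, c) * norm (a, b, c) \<le> 4 * n"
    using large' \<kappa> sq by linarith
  have "(norm (triple_prod (a, b, c) (a, b, c)))\<^sup>2 \<le> (norm (a, b, c) * norm (a, b, c) * K)\<^sup>2"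
    using K by (intro power_mono) auto
  also have "\<dots> = (norm (a, b, c) * norm (a, b, c))\<^sup>2 * K\<^sup>2" by (simp add: power_mult_distrib)
  also have "\<dots> \<le> (4 * n)\<^sup>2 * K\<^sup>2"
    using le4n by (intro mult_right_mono power_mono) auto
  also have "\<dots> = 16 * K\<^sup>2 * norm a ^ 4" by (simp add: n power_mult_distrib)
  also have "norm a ^ 4 = (norm a ^ 3) powr (4 / 3)"
  proof -
    have "norm a ^ 3 = norm a powr 3" "norm a ^ 4 = norm a powr 4"
      using powr_realpow[OF a, of 3] powr_realpow[OF a, of 4] by simp_all
    moreover have "norm a powr 4 = (norm a powr 3) powr (4 / 3)" unfolding powr_powr by simp
    ultimately show ?thesis by simp
  qed
  also have "\<dots> \<le> (3 / \<theta> * energy a b c) powr (4 / 3)"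
    using cube by (intro powr_mono2) auto
  also have "\<dots> = (3 / \<theta>) powr (4 / 3) * energy a b c powr (4 / 3)"
    by (rule powr_mult)
  finally show "(norm (triple_prod (a, b, c) (a, b, c)))\<^sup>2
      \<le> 16 * K\<^sup>2 * (3 / \<theta>) powr (4 / 3) * energy a b c powr (4 / 3)"
    by (simp add: mult_left_mono mult.assoc)
qed

section \<open>The energy bound and the lower bound for the blow-up time\<close>

theorem theorem2:
  fixes a c :: "real \<Rightarrow> real ^ 'm" and b :: "real \<Rightarrow> real ^ 'm ^ 'm"
    and Tstar :: ereal and t0 T1 T2 \<Theta>1 \<Theta>2 :: real and E :: "real \<Rightarrow> real"
  assumes sol: "is_maximal_solution a b c Tstar"
    and E_def: "\<And>t. E t = energy (a t) (b t) (c t)"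
    and t0: "0 \<le> t0" "ereal t0 < Tstar"
    and final: "final_stage (a t0) (b t0) (c t0)"
    and T1: "t0 < T1" "ereal T1 < Tstar"
    and \<Theta>1: "0 \<le> \<Theta>1" "\<Theta>1 < pi / 2"
    and angle1: "\<And>i t. i \<in> blow_up_indices c Tstar \<Longrightarrow> T1 < t \<Longrightarrow> ereal t < Tstar \<Longrightarrow>
                   cos (vec_angle (a t) (c t $ i *\<^sub>R column i (b t))) \<ge> cos \<Theta>1"
    and T2: "T1 < T2" "ereal T2 < Tstar"
    and \<Theta>2: "0 \<le> \<Theta>2" "\<Theta>2 < pi / 2"
    and angle2: "\<And>t. T2 < t \<Longrightarrow> ereal t < Tstar \<Longrightarrow>
                   cos (vec_angle (a t) (vector_derivative a (at t))) \<ge> cos \<Theta>2"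
  shows "\<exists>T3 C :: real. T2 < T3 \<and> ereal T3 < Tstar \<and> 1 \<le> C \<and>
           (\<forall>s t. T3 \<le> s \<longrightarrow> s < t \<longrightarrow> ereal t < Tstar \<longrightarrow>
              0 < E s powr (- 1 / 3) - C * (t - s) \<longrightarrow>
              E t \<le> 1 / (E s powr (- 1 / 3) - C * (t - s)) ^ 3) \<and>
           (\<forall>t. t0 \<le> t \<longrightarrow> ereal t < Tstar \<longrightarrow>
              Tstar \<ge> ereal (t + E t powr (- 1 / 3) / C))"
proof -
  have sol': "is_solution a b c Tstar" using sol by (simp add: is_maximal_solution_def)
  have E_mono: "E s \<le> E t" if "0 \<le> s" "s \<le> t" "ereal t < Tstar" for s t
    unfolding E_def by (rule energy_mono[OF sol' that])
  have "0 < E t0" unfolding E_def by (rule final_stage_energy_pos[OF final])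
  then have E_pos: "0 < E t" if "t0 \<le> t" "ereal t < Tstar" for t
    using E_mono[of t0 t] that t0 by linarith
  define \<theta> where "\<theta> = cos \<Theta>2"
  have \<theta>: "0 < \<theta>" using \<Theta>2 unfolding \<theta>_def by (intro cos_gt_zero_pi) auto
  obtain \<beta> \<gamma> where \<beta>: "\<And>t. t \<in> forward_interval Tstar \<Longrightarrow> b t \<bullet> b t = a t \<bullet> a t + \<beta>"
    and \<gamma>: "\<And>t. t \<in> forward_interval Tstar \<Longrightarrow> c t \<bullet> c t = a t \<bullet> a t + \<gamma>"
    using conserved_norms[OF sol'] by blast
  obtain k where k: "\<And>t i j. t \<in> forward_interval Tstar \<Longrightarrow>
      column i (b t) \<bullet> column j (b t) = c t $ i * c t $ j + k i j"
    by (rule conserved_columns[OF sol']) (assumption | rule that)+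
  obtain K where K: "\<And>x y :: (real^'m) \<times> (real^'m^'m) \<times> (real^'m).
      norm (triple_prod x y) \<le> norm x * norm y * K"
    using bounded_bilinear.bounded[OF bounded_bilinear_triple_prod] by blast
  define R where "R = 1 + \<bar>\<beta>\<bar> + 2 * \<bar>\<gamma>\<bar> + 4 * (\<Sum>i\<in>UNIV. \<Sum>j\<in>UNIV. \<bar>k i j\<bar>)"
  obtain u where u: "T2 < u" "ereal u < Tstar"
    using T2 by (metis ereal_dense2 less_ereal.simps(1))
  have "0 \<le> u" "t0 \<le> u" using u T1 T2 t0 by auto
  then obtain T3 where T3: "u \<le> T3" "ereal T3 < Tstar" "R \<le> a T3 \<bullet> a T3"
    using squared_norm_unbounded[OF sol, of u R] u E_pos[of u] unfolding E_def by blast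
  have T3': "T2 < T3" "t0 < T3" "0 < T3" using T3 u T1 T2 t0 by auto
  have R: "R \<le> a t \<bullet> a t" if "T3 \<le> t" "ereal t < Tstar" for t
  proof -
    have "0 \<le> 2 * energy (a T3) (b T3) (c T3) * (t - T3)"
      using E_pos[of T3] T3 T3' that by (simp add: E_def)
    then show ?thesis
      using squared_norm_growth[OF sol', of T3 t] that T3 T3' by linarith
  qed
  \<comment> \<open>A third of the constant from \<open>energy_bounds_if_norm_large\<close>, to fit
    the factor 3 in \<open>powr_neg_third_decrease\<close>.\<close>
  define C1 where "C1 = 16 * K\<^sup>2 * (3 / \<theta>) powr (4 / 3) / 3"
  define D where "D t = (norm (triple_prod (a t, b t, c t) (a t, b t, c t)))\<^sup>2" for t
  have bounds: "\<theta> / 3 * norm (a t) ^ 3 \<le> E t" "D t \<le> 3 * C1 * E t powr (4 / 3)"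
    and deriv: "(E has_real_derivative D t) (at t)" if t: "T3 \<le> t" "ereal t < Tstar" for t
  proof -
    have mem: "t \<in> forward_interval Tstar" using t T3' by (simp add: forward_interval_def)
    have "vector_derivative a (at t) = b t *v c t"
      using has_vector_derivative_interior_forward_interval[OF deriv_a[OF sol' mem]] t T3'
      by (intro vector_derivative_at) simp
    then have "\<theta> \<le> cos (vec_angle (a t) (b t *v c t))"
      using angle2[of t] t T3' by (simp add: \<theta>_def)
    from inner_ge_if_cos_vec_angle_ge[OF this]
    have angle: "\<theta> * (norm (a t) * norm (b t *v c t)) \<le> energy (a t) (b t) (c t)"
      by (simp add: energy_def)
    note bd = energy_bounds_if_norm_large[OF \<beta>[OF mem] \<gamma>[OF mem] k[OF mem] _ \<theta> angle K]
    show "\<theta> / 3 * norm (a t) ^ 3 \<le> E t"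
      using bd(1) R[OF t] unfolding R_def E_def by blast
    show "D t \<le> 3 * C1 * E t powr (4 / 3)"
      using bd(2) R[OF t] unfolding R_def E_def C1_def D_def by simp
    have "((\<lambda>t. energy (a t) (b t) (c t)) has_vector_derivative D t) (at t)"
      unfolding D_def using has_vector_derivative_interior_forward_interval[OF deriv_energy[OF sol' mem]] t T3' by simp
    then show "(E has_real_derivative D t) (at t)"
      by (simp add: has_real_derivative_iff_has_vector_derivative E_def[abs_def])
  qed
  \<comment> \<open>\<open>C1\<close> serves the differential inequality, which is available only
    from \<open>T3\<close> on. The last entry covers times in \<open>{t0..T3}\<close> in the lower
    bound on a finite \<open>Tstar\<close>: it makes \<open>C\<close> times the remaining time after
    \<open>T3\<close> at least \<open>E t0 powr (- 1 / 3)\<close>, which dominates the value at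
    later times. For infinite \<open>Tstar\<close> that bound is trivial and 1 is a
    placeholder.\<close>
  define C where "C = max (max 1 C1)
    (if Tstar = \<infinity> then 1 else E t0 powr (- 1 / 3) / (real_of_ereal Tstar - T3))"
  have decrease: "E s powr (- 1 / 3) - C * (t - s) \<le> E t powr (- 1 / 3)"
    if st: "T3 \<le> s" "s \<le> t" "ereal t < Tstar" for s t
  proof -
    have lt: "ereal v < Tstar" if "v \<le> t" for v
      using that st by (meson ereal_less_eq(3) order_le_less_trans)
    have "E s powr (- 1 / 3) - C1 * (t - s) \<le> E t powr (- 1 / 3)"
      by (rule powr_neg_third_decrease[OF \<open>s \<le> t\<close>, where E' = D])
        (use st T3' lt in \<open>auto intro!: deriv E_pos bounds(2)\<close>)
    moreover have "C1 * (t - s) \<le> C * (t - s)"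
      using st by (intro mult_right_mono) (auto simp: C_def)
    ultimately show ?thesis by linarith
  qed
  have upper: "E t \<le> 1 / (E s powr (- 1 / 3) - C * (t - s)) ^ 3"
    if "T3 \<le> s" "s \<le> t" "ereal t < Tstar" "0 < E s powr (- 1 / 3) - C * (t - s)" for s t
    using le_inverse_cube_if_powr_neg_third_ge[OF that(4) decrease[OF that(1-3)]] E_pos[of t] that T3'
    by simp
  have C: "1 \<le> C" by (simp add: C_def)
  have lower: "ereal (t + E t powr (- 1 / 3) / C) \<le> Tstar" if t: "t0 \<le> t" "ereal t < Tstar" for t
  proof (cases Tstar)
    case (real r)
    have "E t powr (- 1 / 3) \<le> C * (r - t)"
    proof (cases "t \<le> T3")
      case True
      have r: "T3 < r" using T3 real by simp
      have "E t powr (- 1 / 3) \<le> E t0 powr (- 1 / 3)"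
        using E_mono[of t0 t] t t0 E_pos[of t0] by (intro powr_mono2') auto
      also have "\<dots> = E t0 powr (- 1 / 3) / (r - T3) * (r - T3)" using r by simp
      also have "\<dots> \<le> C * (r - t)"
        using True r C real by (intro mult_mono) (auto simp: C_def)
      finally show ?thesis .
    next
      case False
      show ?thesis
      proof (rule ccontr)
        \<comment> \<open>A positive gap would keep the energy below
          \<open>1 / \<epsilon> ^ 3\<close> all the way from \<open>t\<close> to \<open>r\<close>,
          although it dominates the cube of the unbounded norm of \<open>a\<close>.\<close>
        define \<epsilon> where "\<epsilon> = E t powr (- 1 / 3) - C * (r - t)"
        assume "\<not> ?thesis"
        then have \<epsilon>: "0 < \<epsilon>" by (simp add: \<epsilon>_def)
        have pos: "0 \<le> t" "0 < energy (a t) (b t) (c t)"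
          using t t0 E_pos[of t] by (auto simp: E_def)
        \<comment> \<open>The threshold makes the lower bound on the energy at \<open>v\<close> at
          least \<open>1 / \<epsilon> ^ 3 + 1\<close>. The entry 1 in the maximum makes the norm of
          \<open>a v\<close> at least 1, so that its cube dominates its square.\<close>
        obtain v where v: "t \<le> v" "ereal v < Tstar" "max 1 (3 / \<theta> * (1 / \<epsilon> ^ 3 + 1)) \<le> a v \<bullet> a v"
          using squared_norm_unbounded[OF sol pos(1) t(2) pos(2),
              of "max 1 (3 / \<theta> * (1 / \<epsilon> ^ 3 + 1))"]
          by blast
        have \<epsilon>_le: "\<epsilon> \<le> E t powr (- 1 / 3) - C * (v - t)"
          using v real C by (simp add: \<epsilon>_def)
        have "E v \<le> 1 / (E t powr (- 1 / 3) - C * (v - t)) ^ 3"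
          using upper[of t v] v \<epsilon>_le \<epsilon> False by simp
        also have "\<dots> \<le> 1 / \<epsilon> ^ 3"
          using \<epsilon> \<epsilon>_le by (intro divide_left_mono power_mono mult_pos_pos zero_less_power) auto
        finally have Ev: "E v \<le> 1 / \<epsilon> ^ 3" .
        have "1 \<le> norm (a v)" using v(3) by (simp add: norm_eq_sqrt_inner)
        then have "(norm (a v))\<^sup>2 \<le> norm (a v) ^ 3" by (intro power_increasing) auto
        then have "3 / \<theta> * (1 / \<epsilon> ^ 3 + 1) \<le> norm (a v) ^ 3"
          using v(3) by (simp add: power2_norm_eq_inner)
        then have "\<theta> / 3 * (3 / \<theta> * (1 / \<epsilon> ^ 3 + 1)) \<le> \<theta> / 3 * norm (a v) ^ 3"
          using \<theta> by (intro mult_left_mono) auto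
        also have "\<dots> \<le> E v" using bounds(1)[of v] v False by simp
        finally show False using Ev \<theta> by simp
      qed
    qed
    then show ?thesis using C real by (simp add: field_simps)
  qed (use t in auto)
  show ?thesis
  proof (intro exI conjI allI impI)
    show "T2 < T3" "ereal T3 < Tstar" "1 \<le> C" using T3 T3' C by auto
    show "E t \<le> 1 / (E s powr (- 1 / 3) - C * (t - s)) ^ 3"
      if "T3 \<le> s" "s < t" "ereal t < Tstar" "0 < E s powr (- 1 / 3) - C * (t - s)" for s t
      using upper[OF that(1) less_imp_le[OF that(2)] that(3,4)] .
    show "ereal (t + E t powr (- 1 / 3) / C) \<le> Tstar" if "t0 \<le> t" "ereal t < Tstar" for t
      using lower[OF that] .
  qed
qed

end
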